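(* Let $X$ be a (real) Banach space. For every metrizable space $U$, continuous function $x:U\to\mathbb{R}$ and continuous function $f:U\times\mathbb{R}\to X$ define $\sum^x(f):U\to X$ using the Bochner integral: $$\sum^{x}(f)(u):=\int_0^{x(u)}f(u,t)\,dt=\begin{cases}\int_{[0,x(u)]}f(u,t)\,dt,& x(u)\ge0\\ -\int_{[x(u),0]}f(u,t)\,dt,& x(u)<0.\end{cases}$$ Then $X$ is a dependent right $\mathbb{R}$-module.
   Context: $\mathrm{Top}_{mtr}$ is the category of metrizable topological spaces and continuous maps. The dependent adder $\mathbb{R}$ in $\mathrm{Top}_{mtr}$: $A=\mathbb{R}$, $F=\mathbb{R}\times\mathbb{R}$, $p:F\to\mathbb{R}$ the second projection; for continuous $x:U\to\mathbb{R}$, $\llbracket x\rrbracket=U\times_{\mathbb{R}}F$ is identified with $U\times\mathbb{R}$; for continuous $f:U\times\mathbb{R}\to\mathbb{R}$, $(\sum^x f)(u)=\int_0^{x(u)}f(u,t)\,dt$ (oriented integral) and $f^\flat:U\times\mathbb{R}\times\mathbb{R}\to U\times\mathbb{R}$, $f^\flat(u,a,b)=(u,\int_0^a f(u,t)\,dt)$. A dependent right $\mathbb{R}$-module consists of a metrizable space $M$ and, for every metrizable $U$ and continuous $x:U\to\mathbb{R}$, a function $\sum^x:\mathrm{Hom}_{\mathrm{Top}_{mtr}}(U\times\mathbb{R},M)\to\mathrm{Hom}_{\mathrm{Top}_{mtr}}(U,M)$, such that: (Naturality) for continuous $h:U\to U'$, $y:U'\to\mathbb{R}$ with $x=y\circ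 h$, and $g:U'\times\mathbb{R}\to M$, $\sum^x(g\circ(h\times\mathrm{id}))=(\sum^y g)\circ h$; (Unit) for $x:U\to\mathbb{R}$ and $f:\llbracket x\rrbracket=U\times\mathbb{R}\to M$, $\sum^{const_1}(f\circ const_1^\flat)=f$, where $const_1:\llbracket x\rrbracket\to\mathbb{R}$ is constant with value $1$; (Sum Associativity) for $x:U\to\mathbb{R}$, $f:\llbracket x\rrbracket\to\mathbb{R}$ and $g:\llbracket\sum^x f\rrbracket\to M$, $\sum^{\sum^x f}g=\sum^x\sum^f(g\circ f^\flat)$. *)

theory Defs
  imports "HOL-Analysis.Analysis"
begin

section \<open>The Bochner integral in an arbitrary Banach space\<close>

text \<open>
  The library constants \<^const>\<open>has_bochner_integral\<close> and \<^const>\<open>lebesgue_integral\<close> carry the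
  sort constraint of second countability, i.e. they only cover separable Banach spaces. The two
  definitions below repeat the library definitions without that constraint: \<open>f\<close> is measurable and
  is approximated in L1 by integrable simple functions, whose integrals converge to \<open>I\<close>. Such an
  \<open>f\<close> is automatically almost everywhere separably valued.
\<close>

definition bochner_has_integral ::
    "'a measure \<Rightarrow> ('a \<Rightarrow> 'b::real_normed_vector) \<Rightarrow> 'b \<Rightarrow> bool" where
  "bochner_has_integral M f I \<longleftrightarrow>
     f \<in> borel_measurable M \<and>
     (\<exists>s. (\<forall>i. Bochner_Integration.simple_bochner_integrable M (s i)) \<and>
          (\<lambda>i::nat. \<integral>\<^sup>+t. ennreal (norm (f t - s i t)) \<partial>M) \<longlonglongrightarrow> 0 \<and>
          (\<lambda>i. Bochner_Integration.simple_bochner_integral M (s i)) \<longlonglongrightarrow> I)"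

definition bochner_integral :: "'a measure \<Rightarrow> ('a \<Rightarrow> 'b::real_normed_vector) \<Rightarrow> 'b" where
  "bochner_integral M f =
     (if \<exists>I. bochner_has_integral M f I then THE I. bochner_has_integral M f I else 0)"

lemma bochner_has_integral_eq_library:
  fixes f :: "'a \<Rightarrow> 'b::{real_normed_vector, second_countable_topology}"
  shows "bochner_has_integral M f I \<longleftrightarrow> has_bochner_integral M f I"
  unfolding bochner_has_integral_def has_bochner_integral.simps by auto

lemma bochner_integral_eq_library:
  fixes f :: "'a \<Rightarrow> 'b::{real_normed_vector, second_countable_topology}"
  shows "bochner_integral M f = lebesgue_integral M f"
  unfolding bochner_integral_def lebesgue_integral_def bochner_has_integral_eq_library ..

definition oriented_bochner_integral :: "real \<Rightarrow> (real \<Rightarrow> 'b::real_normed_vector) \<Rightarrow> 'b" where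
  "oriented_bochner_integral a f =
     (if 0 \<le> a then bochner_integral (lebesgue_on {0..a}) f
      else - bochner_integral (lebesgue_on {a..0}) f)"


section \<open>Morphisms of topological spaces and the dependent adder of the reals\<close>

text \<open>
  Spaces are topologies on a subset of a type. Morphisms are made extensional (they take the value
  \<^const>\<open>undefined\<close> outside the carrier), so that HOL equality of morphisms is equality
  of maps between the carriers. Accordingly, composites are formed with \<^const>\<open>compose\<close>.
\<close>

definition top_hom :: "'a topology \<Rightarrow> 'b topology \<Rightarrow> ('a \<Rightarrow> 'b) set" where
  "top_hom U V = {f \<in> extensional (topspace U). continuous_map U V f}"

text \<open>For every \<open>x\<close> from \<open>U\<close> to the reals, the pullback of \<open>x\<close> along the second projection
  of the plane is identified with the product of \<open>U\<close> and the reals.\<close>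

abbreviation times_R :: "'u topology \<Rightarrow> ('u \<times> real) topology" where
  "times_R U \<equiv> prod_topology U euclideanreal"

definition adder_sum ::
    "'u topology \<Rightarrow> ('u \<Rightarrow> real) \<Rightarrow> ('u \<times> real \<Rightarrow> real) \<Rightarrow> 'u \<Rightarrow> real" where
  "adder_sum U x f = (\<lambda>u\<in>topspace U. LBINT t=0..x u. f (u, t))"

definition adder_flat ::
    "'u topology \<Rightarrow> ('u \<times> real \<Rightarrow> real) \<Rightarrow> ('u \<times> real) \<times> real \<Rightarrow> 'u \<times> real" where
  "adder_flat U f =
     restrict (\<lambda>((u, a), b). (u, LBINT t=0..a. f (u, t))) (topspace (times_R (times_R U)))"

definition adder_one :: "'u topology \<Rightarrow> 'u \<times> real \<Rightarrow> real" where
  "adder_one U = (\<lambda>_\<in>topspace (times_R U). 1)"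


section \<open>Dependent right modules over the reals\<close>

text \<open>
  The summation operation of a module is a family indexed by all metrizable spaces. HOL cannot
  quantify over types inside a formula, so the predicate below receives the members of the family
  at the carrier types that occur in the axioms: \<open>S\<close> for spaces \<open>U\<close> over \<open>'u\<close>, \<open>S'\<close> for spaces
  \<open>U'\<close> over \<open>'v\<close>, and \<open>SR\<close> for spaces over \<open>'u \<times> real\<close>. A family given by one polymorphic
  constant is a dependent right module iff the predicate holds for its instances at arbitrary
  types \<open>'u\<close> and \<open>'v\<close>.
\<close>

type_synonym ('u, 'm) dep_sum =
  "'u topology \<Rightarrow> ('u \<Rightarrow> real) \<Rightarrow> ('u \<times> real \<Rightarrow> 'm) \<Rightarrow> 'u \<Rightarrow> 'm"

definition dep_sum_operation :: "'m topology \<Rightarrow> ('u, 'm) dep_sum \<Rightarrow> bool" where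
  "dep_sum_operation M S \<longleftrightarrow>
     (\<forall>U x f. metrizable_space U \<and> x \<in> top_hom U euclideanreal \<and> f \<in> top_hom (times_R U) M
        \<longrightarrow> S U x f \<in> top_hom U M)"

definition dep_sum_natural ::
    "'m topology \<Rightarrow> ('u, 'm) dep_sum \<Rightarrow> ('v, 'm) dep_sum \<Rightarrow> bool" where
  "dep_sum_natural M S S' \<longleftrightarrow>
     (\<forall>U U' h x y g. metrizable_space U \<and> metrizable_space U' \<and>
        h \<in> top_hom U U' \<and> x \<in> top_hom U euclideanreal \<and> y \<in> top_hom U' euclideanreal \<and>
        x = compose (topspace U) y h \<and> g \<in> top_hom (times_R U') M
        \<longrightarrow> S U x (compose (topspace (times_R U)) g (map_prod h id))
            = compose (topspace U) (S' U' y g) h)"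

definition dep_sum_unit :: "'m topology \<Rightarrow> ('u \<times> real, 'm) dep_sum \<Rightarrow> bool" where
  "dep_sum_unit M SR \<longleftrightarrow>
     (\<forall>U x f. metrizable_space U \<and> x \<in> top_hom U euclideanreal \<and> f \<in> top_hom (times_R U) M
        \<longrightarrow> SR (times_R U) (adder_one U)
              (compose (topspace (times_R (times_R U))) f (adder_flat U (adder_one U))) = f)"

definition dep_sum_assoc ::
    "'m topology \<Rightarrow> ('u, 'm) dep_sum \<Rightarrow> ('u \<times> real, 'm) dep_sum \<Rightarrow> bool" where
  "dep_sum_assoc M S SR \<longleftrightarrow>
     (\<forall>U x f g. metrizable_space U \<and> x \<in> top_hom U euclideanreal \<and>
        f \<in> top_hom (times_R U) euclideanreal \<and> g \<in> top_hom (times_R U) M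
        \<longrightarrow> S U (adder_sum U x f) g
            = S U x (SR (times_R U) f
                (compose (topspace (times_R (times_R U))) g (adder_flat U f))))"

definition dependent_right_R_module ::
    "'m topology \<Rightarrow> ('u, 'm) dep_sum \<Rightarrow> ('v, 'm) dep_sum \<Rightarrow> ('u \<times> real, 'm) dep_sum \<Rightarrow> bool" where
  "dependent_right_R_module M S S' SR \<longleftrightarrow>
     metrizable_space M \<and>
     dep_sum_operation M S \<and> dep_sum_operation M S' \<and> dep_sum_operation M SR \<and>
     dep_sum_natural M S S' \<and> dep_sum_unit M SR \<and> dep_sum_assoc M S SR"

definition bochner_sum :: "('u, 'x::banach) dep_sum" where
  "bochner_sum U x f = (\<lambda>u\<in>topspace U. oriented_bochner_integral (x u) (\<lambda>t. f (u, t)))"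

end

theory Submission
  imports Defs
begin

text \<open>
  For continuous functions on the line the integral in question is governed by the fundamental
  theorem of calculus: \<open>a \<mapsto> \<integral>\<^sub>0\<^sup>a f\<close> is the primitive of \<open>f\<close> that vanishes at \<open>0\<close>. All three axioms are
  consequences. Naturality holds because the integral at \<open>u\<close> involves only \<open>x u\<close> and the slice
  \<open>f (u, _)\<close>. For the other two laws, an integrand of the form \<open>b \<mapsto> g (f\<^sup>\<flat> (u, a, b))\<close> is
  constant, with value \<open>g (u, \<Phi> a)\<close> where \<open>\<Phi> a = \<integral>\<^sub>0\<^sup>a f (u, t) dt\<close>, so that its integral is just a
  scalar multiple of this value. The unit law is the case \<open>f = 1\<close>, \<open>\<Phi> a = a\<close>, and associativity is the
  substitution rule \<open>\<integral>\<^sub>0\<^bsup>\<Phi> x\<^esup> g (u, s) ds = \<integral>\<^sub>0\<^sup>x f (u, a) g (u, \<Phi> a) da\<close>, that is, the chain rule for the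
  primitive of \<open>g (u, _)\<close> composed with \<open>\<Phi>\<close>
  (\<open>oriented_bochner_integral_substitution\<close>).

  Two points need work. First, \<open>X\<close> may be non-separable, so the Bochner integral has to be related
  to calculus by hand. The Henstock-Kurzweil integral makes sense in every Banach space and comes
  with the fundamental theorem of calculus; a continuous function on a compact interval is a uniform
  limit of step functions, on which both integrals agree, hence they agree on the limit
  (\<open>bochner_has_integral_continuous\<close>). Second, the sum must depend continuously on the parameter
  \<open>u\<close>. Rescaling to the fixed interval \<open>[0, 1]\<close> moves the variable bound \<open>x u\<close> into the integrand,
  and by the tube lemma a jointly continuous integrand varies little with \<open>u\<close>, uniformly over the
  compact interval (\<open>continuous_map_oriented_bochner_integral\<close>).
\<close>

section \<open>Uniqueness of the Bochner integral\<close>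

text \<open>
  In a non-separable space sums and differences of measurable functions may fail to be measurable.
  Subtracting a simple function is harmless because on each of its finitely many level sets a
  constant is subtracted, which is a continuous operation.
\<close>

lemma borel_measurable_norm_diff_simple:
  fixes f s :: "'a \<Rightarrow> 'b::real_normed_vector"
  assumes f: "f \<in> borel_measurable M" and s: "simple_function M s"
  shows "(\<lambda>t. norm (f t - s t)) \<in> borel_measurable M"
proof (rule measurable_compose_countable'[where I = "s ` space M" and g = s])
  show "(\<lambda>t. norm (f t - y)) \<in> borel_measurable M" for y
    by (rule measurable_compose[OF f]) (intro borel_measurable_continuous_onI continuous_intros)
  show "s \<in> measurable M (count_space (s ` space M))"
    using s by (auto simp: measurable_count_space_eq2 simple_function_def)
  show "countable (s ` space M)"
    using s by (simp add: simple_function_def countable_finite)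
qed

text \<open>
  Two simple functions close to \<open>f\<close> in the \<open>L\<^sup>1\<close> sense are close to each other, and for simple
  functions the integral is a contraction. Hence the limit of the integrals of an approximating
  sequence does not depend on the sequence.
\<close>

lemma simple_bochner_integral_dist_le:
  fixes f s s' :: "'a \<Rightarrow> 'b::real_normed_vector"
  assumes f: "f \<in> borel_measurable M"
    and s: "Bochner_Integration.simple_bochner_integrable M s"
    and s': "Bochner_Integration.simple_bochner_integrable M s'"
  shows "ennreal (norm (Bochner_Integration.simple_bochner_integral M s -
                        Bochner_Integration.simple_bochner_integral M s'))
         \<le> (\<integral>\<^sup>+t. norm (f t - s t) \<partial>M) + (\<integral>\<^sup>+t. norm (f t - s' t) \<partial>M)"
proof -
  have simple: "simple_function M s" "simple_function M s'"
    using s s' by (auto elim: simple_bochner_integrable.cases)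
  have [measurable]: "(\<lambda>t. norm (f t - s t)) \<in> borel_measurable M"
    "(\<lambda>t. norm (f t - s' t)) \<in> borel_measurable M"
    using borel_measurable_norm_diff_simple[OF f] simple by auto
  have diff: "Bochner_Integration.simple_bochner_integrable M (\<lambda>t. s t - s' t)"
    by (rule simple_bochner_integrable_compose2[OF _ s s']) simp
  have norm_diff: "Bochner_Integration.simple_bochner_integrable M (\<lambda>t. norm (s t - s' t))"
    by (rule simple_bochner_integrable_compose2[OF _ s s', where p = "\<lambda>y z. norm (y - z)"]) simp
  have "ennreal (norm (Bochner_Integration.simple_bochner_integral M s -
                       Bochner_Integration.simple_bochner_integral M s'))
      \<le> ennreal (Bochner_Integration.simple_bochner_integral M (\<lambda>t. norm (s t - s' t)))"
    unfolding simple_bochner_integral_diff[OF s s', symmetric]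
    by (intro ennreal_leI simple_bochner_integral_norm_bound diff)
  also have "\<dots> = (\<integral>\<^sup>+t. norm (s t - s' t) \<partial>M)"
    by (rule simple_bochner_integral_eq_nn_integral[OF norm_diff]) simp
  also have "\<dots> \<le> (\<integral>\<^sup>+t. ennreal (norm (f t - s t)) + ennreal (norm (f t - s' t)) \<partial>M)"
  proof (rule nn_integral_mono)
    fix t
    have "norm (s t - s' t) \<le> norm (f t - s t) + norm (f t - s' t)"
      using norm_triangle_ineq4[of "f t - s' t" "f t - s t"] by simp
    then show "ennreal (norm (s t - s' t)) \<le> ennreal (norm (f t - s t)) + ennreal (norm (f t - s' t))"
      by (simp flip: ennreal_plus add: ennreal_leI)
  qed
  also have "\<dots> = (\<integral>\<^sup>+t. norm (f t - s t) \<partial>M) + (\<integral>\<^sup>+t. norm (f t - s' t) \<partial>M)"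
    by (rule nn_integral_add) auto
  finally show ?thesis .
qed

lemma bochner_has_integral_unique:
  assumes "bochner_has_integral M f I" "bochner_has_integral M f J"
  shows "I = J"
proof -
  let ?sbi = "Bochner_Integration.simple_bochner_integral M"
  obtain s where f: "f \<in> borel_measurable M"
    and s: "\<And>i. Bochner_Integration.simple_bochner_integrable M (s i)"
      "(\<lambda>i::nat. \<integral>\<^sup>+t. ennreal (norm (f t - s i t)) \<partial>M) \<longlonglongrightarrow> 0"
      "(\<lambda>i. ?sbi (s i)) \<longlonglongrightarrow> I"
    using assms(1) unfolding bochner_has_integral_def by blast
  obtain s' where s': "\<And>i. Bochner_Integration.simple_bochner_integrable M (s' i)"
      "(\<lambda>i::nat. \<integral>\<^sup>+t. ennreal (norm (f t - s' i t)) \<partial>M) \<longlonglongrightarrow> 0"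
      "(\<lambda>i. ?sbi (s' i)) \<longlonglongrightarrow> J"
    using assms(2) unfolding bochner_has_integral_def by blast
  let ?d = "\<lambda>i. ?sbi (s i) - ?sbi (s' i)"
  have "(\<lambda>i. (\<integral>\<^sup>+t. norm (f t - s i t) \<partial>M) + (\<integral>\<^sup>+t. norm (f t - s' i t) \<partial>M)) \<longlonglongrightarrow> 0 + 0"
    by (intro tendsto_add s s')
  then have bound_tendsto:
    "(\<lambda>i. (\<integral>\<^sup>+t. norm (f t - s i t) \<partial>M) + (\<integral>\<^sup>+t. norm (f t - s' i t) \<partial>M)) \<longlonglongrightarrow> 0"
    by simp
  have "(\<lambda>i. ennreal (norm (?d i))) \<longlonglongrightarrow> 0"
    by (rule tendsto_sandwich[OF _ _ tendsto_const bound_tendsto])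
      (use simple_bochner_integral_dist_le[OF f s(1) s'(1)] in simp_all)
  then have "?d \<longlonglongrightarrow> 0"
    using tendsto_ennreal_iff[of "\<lambda>i. norm (?d i)" sequentially 0]
    by (simp add: tendsto_norm_zero_iff)
  moreover have "?d \<longlonglongrightarrow> I - J"
    by (intro tendsto_diff s s')
  ultimately show "I = J"
    using LIMSEQ_unique by fastforce
qed

lemma bochner_integral_eqI:
  "bochner_has_integral M f I \<Longrightarrow> bochner_integral M f = I"
  unfolding bochner_integral_def
  by (auto intro!: the_equality dest: bochner_has_integral_unique)

section \<open>The Bochner integral of a continuous function on an interval\<close>

text \<open>
  Both integrals are linear, and on the indicator of a measurable level set both give its measure.
\<close>

lemma simple_function_has_integral:
  fixes s :: "real \<Rightarrow> 'b::real_normed_vector"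
  assumes s: "simple_function (lebesgue_on {a..b}) s"
  shows "(s has_integral Bochner_Integration.simple_bochner_integral (lebesgue_on {a..b}) s) {a..b}"
proof -
  have fin: "finite (s ` {a..b})"
    using s by (simp add: simple_function_def)
  have level: "((\<lambda>t. indicator {t \<in> {a..b}. s t = y} t *\<^sub>R y) has_integral
      measure (lebesgue_on {a..b}) {t \<in> {a..b}. s t = y} *\<^sub>R y) {a..b}" if "y \<in> s ` {a..b}" for y
  proof -
    have "s -` {y} \<inter> {a..b} \<in> sets (lebesgue_on {a..b})"
      using s that by (auto simp add: simple_function_def simp del: sets_restrict_space)
    moreover have "s -` {y} \<inter> {a..b} = {t \<in> {a..b}. s t = y}" by auto
    ultimately have meas: "{t \<in> {a..b}. s t = y} \<in> sets lebesgue"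
      by (simp add: sets_restrict_space_iff)
    then have lm: "{t \<in> {a..b}. s t = y} \<in> lmeasurable"
      by (rule bounded_set_imp_lmeasurable[rotated]) (rule bounded_subset[of "{a..b}"], auto)
    have "{t \<in> {a..b}. s t = y} \<inter> {a..b} = {t \<in> {a..b}. s t = y}" by auto
    then have "((\<lambda>t. indicator {t \<in> {a..b}. s t = y} t :: real) has_integral
        measure lebesgue {t \<in> {a..b}. s t = y}) {a..b}"
      using lm integral_indicator[of "{t \<in> {a..b}. s t = y}" "{a..b}"]
        integrable_on_indicator[of "{t \<in> {a..b}. s t = y}" "{a..b}"]
      by (simp add: has_integral_iff)
    moreover have "measure (lebesgue_on {a..b}) {t \<in> {a..b}. s t = y} = measure lebesgue {t \<in> {a..b}. s t = y}"
      by (rule measure_restrict_space) auto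
    ultimately show ?thesis
      by (simp only: has_integral_scaleR_left)
  qed
  have "((\<lambda>t. \<Sum>y\<in>s ` {a..b}. indicator {t \<in> {a..b}. s t = y} t *\<^sub>R y) has_integral
      (\<Sum>y\<in>s ` {a..b}. measure (lebesgue_on {a..b}) {t \<in> {a..b}. s t = y} *\<^sub>R y)) {a..b}"
    by (intro has_integral_sum fin level)
  then have "((\<lambda>t. \<Sum>y\<in>s ` {a..b}. indicator {t \<in> {a..b}. s t = y} t *\<^sub>R y) has_integral
      Bochner_Integration.simple_bochner_integral (lebesgue_on {a..b}) s) {a..b}"
    by (simp add: simple_bochner_integral_def)
  moreover have "(\<Sum>y\<in>s ` {a..b}. indicator {t \<in> {a..b}. s t = y} t *\<^sub>R y) = s t"
    if "t \<in> {a..b}" for t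
  proof -
    have "(\<Sum>y\<in>s ` {a..b}. indicator {t \<in> {a..b}. s t = y} t *\<^sub>R y)
        = (\<Sum>y\<in>s ` {a..b}. if s t = y then y else 0)"
      using that by (intro sum.cong) (auto simp: indicator_def)
    then show ?thesis using fin that by simp
  qed
  ultimately show ?thesis
    by (rule has_integral_eq[rotated])
qed

text \<open>
  By uniform continuity, sampling \<open>f\<close> at the left end of the cell of a sufficiently fine grid
  gives a step function uniformly close to \<open>f\<close>.
\<close>

lemma continuous_uniform_simple_approximation:
  fixes f :: "real \<Rightarrow> 'b::real_normed_vector"
  assumes f: "continuous_on {a..b} f" and e: "e > 0"
  obtains s where "simple_function (lebesgue_on {a..b}) s"
    "\<And>t. t \<in> {a..b} \<Longrightarrow> norm (f t - s t) \<le> e"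
proof -
  obtain d where d: "d > 0"
    "\<And>t t'. t \<in> {a..b} \<Longrightarrow> t' \<in> {a..b} \<Longrightarrow> dist t' t < d \<Longrightarrow> dist (f t') (f t) < e"
    by (rule uniformly_continuous_onE[OF compact_uniformly_continuous[OF f compact_Icc] e]) blast
  \<comment> \<open>\<open>k t\<close> is the index of the cell of width \<open>d/2\<close> that contains \<open>t\<close>.\<close>
  define k where "k = (\<lambda>t. \<lfloor>(t - a) / (d/2)\<rfloor>)"
  define s where "s = (\<lambda>t. f (a + (d/2) * real_of_int (k t)))"
  have "k ` {a..b} \<subseteq> {k a..k b}"
    unfolding k_def using d(1) by (auto intro!: floor_mono divide_right_mono)
  then have "finite (k ` {a..b})" 
    using finite_subset by blast
  moreover have "k -` {i} \<inter> {a..b} \<in> sets (lebesgue_on {a..b})" for i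
  proof -
    have "k \<in> measurable borel (count_space UNIV)"
      unfolding k_def by measurable
    then have "k -` {i} \<inter> space borel \<in> sets borel"
      by (rule measurable_sets) simp
    then show ?thesis
      by (auto simp: sets_restrict_space_iff intro!: sets.Int)
  qed
  ultimately have "simple_function (lebesgue_on {a..b}) k"
    by (simp add: simple_function_def)
  then have "simple_function (lebesgue_on {a..b}) s"
    unfolding s_def by (rule simple_function_compose1)
  moreover have "norm (f t - s t) \<le> e" if t: "t \<in> {a..b}" for t
  proof -
    have "real_of_int (k t) \<le> (t - a) / (d/2)" "(t - a) / (d/2) < real_of_int (k t) + 1"
      unfolding k_def by linarith+
    then have "(d/2) * real_of_int (k t) \<le> t - a" "t - a < (d/2) * real_of_int (k t) + d/2"
      using d(1) by (auto simp: field_simps)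
    moreover have "0 \<le> (d/2) * real_of_int (k t)"
      using d(1) t by (simp add: k_def)
    ultimately have "dist t (a + (d/2) * real_of_int (k t)) < d" "a + (d/2) * real_of_int (k t) \<in> {a..b}"
      using t d(1) by (auto simp: dist_real_def)
    then show ?thesis
      using d(2)[of "a + (d/2) * real_of_int (k t)" t] t by (simp add: s_def dist_norm)
  qed
  ultimately show thesis ..
qed

text \<open>
  A single sequence of uniformly close simple functions serves both purposes: it is an
  approximation in \<open>L\<^sup>1\<close> since the interval has finite measure, and the same error bound shows that
  its integrals converge to the Henstock-Kurzweil integral of \<open>f\<close>.
\<close>

lemma bochner_has_integral_continuous:
  fixes f :: "real \<Rightarrow> 'b::banach"
  assumes f: "continuous_on {a..b} f"
  shows "bochner_has_integral (lebesgue_on {a..b}) f (integral {a..b} f)"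
proof -
  let ?M = "lebesgue_on {a..b}"
  have "\<exists>s. simple_function ?M s \<and> (\<forall>t\<in>{a..b}. norm (f t - s t) \<le> 1 / Suc n)" for n
    by (rule continuous_uniform_simple_approximation[OF f, of "1 / Suc n"]) auto
  then obtain s where simple: "\<And>n. simple_function ?M (s n)"
    and approx: "\<And>n t. t \<in> {a..b} \<Longrightarrow> norm (f t - s n t) \<le> 1 / Suc n"
    by metis
  have small: "(\<lambda>n. 1 / Suc n * measure lebesgue {a..b}) \<longlonglongrightarrow> 0"
    using tendsto_mult_right_zero[OF LIMSEQ_inverse_real_of_nat] by (simp add: inverse_eq_divide tendsto_mult_left_zero)
  have "f \<in> borel_measurable ?M"
    using f by (rule continuous_imp_measurable_on_sets_lebesgue) auto
  moreover have "Bochner_Integration.simple_bochner_integrable ?M (s n)" for n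
  proof
    have "emeasure ?M {t \<in> space ?M. s n t \<noteq> 0} \<le> emeasure ?M (space ?M)"
      by (intro emeasure_mono) auto
    also have "\<dots> < \<infinity>"
      by (simp add: emeasure_restrict_space emeasure_lborel_Icc_eq)
    finally show "emeasure ?M {t \<in> space ?M. s n t \<noteq> 0} \<noteq> \<infinity>" by simp
  qed (rule simple)
  moreover have "(\<lambda>n. \<integral>\<^sup>+t. ennreal (norm (f t - s n t)) \<partial>?M) \<longlonglongrightarrow> 0"
  proof (rule tendsto_sandwich[OF _ _ tendsto_const])
    show "\<forall>\<^sub>F n in sequentially. (\<integral>\<^sup>+t. ennreal (norm (f t - s n t)) \<partial>?M)
        \<le> ennreal (1 / Suc n * measure lebesgue {a..b})"
    proof (intro always_eventually allI)
      fix n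
      have "(\<integral>\<^sup>+t. ennreal (norm (f t - s n t)) \<partial>?M) \<le> (\<integral>\<^sup>+t. ennreal (1 / Suc n) \<partial>?M)"
        using approx by (intro nn_integral_mono ennreal_leI) auto
      also have "\<dots> = ennreal (1 / Suc n * measure lebesgue {a..b})"
        by (auto simp: emeasure_restrict_space emeasure_lborel_Icc_eq simp flip: ennreal_mult)
      finally show "(\<integral>\<^sup>+t. ennreal (norm (f t - s n t)) \<partial>?M)
        \<le> ennreal (1 / Suc n * measure lebesgue {a..b})" .
    qed
    show "(\<lambda>n. ennreal (1 / Suc n * measure lebesgue {a..b})) \<longlonglongrightarrow> 0"
      using tendsto_ennrealI[OF small] by simp
  qed (auto intro!: always_eventually)
  moreover have "(\<lambda>n. Bochner_Integration.simple_bochner_integral ?M (s n)) \<longlonglongrightarrow> integral {a..b} f"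
  proof (rule LIM_zero_cancel, rule Lim_null_comparison)
    show "\<forall>\<^sub>F n in sequentially. norm (Bochner_Integration.simple_bochner_integral ?M (s n) - integral {a..b} f)
        \<le> 1 / Suc n * measure lebesgue {a..b}"
    proof (intro always_eventually allI)
      fix n
      have "((\<lambda>t. s n t - f t) has_integral
          Bochner_Integration.simple_bochner_integral ?M (s n) - integral {a..b} f) {a..b}"
        by (intro has_integral_diff simple_function_has_integral simple integrable_integral
            integrable_continuous_interval f)
      then show "norm (Bochner_Integration.simple_bochner_integral ?M (s n) - integral {a..b} f)
          \<le> 1 / Suc n * measure lebesgue {a..b}"
        using has_integral_bound[of "1 / Suc n" "\<lambda>t. s n t - f t" _ a b] approx[of _ n]
        by (simp add: norm_minus_commute[of "s n _"])
    qed
  qed (rule small)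
  ultimately show ?thesis
    unfolding bochner_has_integral_def by blast
qed

section \<open>Calculus of the oriented integral\<close>

text \<open>
  The minima and maxima treat both signs of \<open>a\<close> at once. The derivative is only required within the
  range of integration, so that the lemma also applies to primitives built on a bounded interval.
\<close>

lemma oriented_bochner_integral_FTC:
  fixes f G :: "real \<Rightarrow> 'b::banach"
  assumes f: "continuous_on {min 0 a..max 0 a} f"
    and G: "\<And>t. t \<in> {min 0 a..max 0 a} \<Longrightarrow>
      (G has_vector_derivative f t) (at t within {min 0 a..max 0 a})"
  shows "oriented_bochner_integral a f = G a - G 0"
proof -
  have "bochner_integral (lebesgue_on {min 0 a..max 0 a}) f = integral {min 0 a..max 0 a} f"
    by (intro bochner_integral_eqI bochner_has_integral_continuous f)
  also have "\<dots> = G (max 0 a) - G (min 0 a)"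
    by (intro integral_unique fundamental_theorem_of_calculus G) auto
  finally show ?thesis
    by (auto simp: oriented_bochner_integral_def)
qed

lemma oriented_bochner_integral_0:
  fixes f :: "real \<Rightarrow> 'b::banach"
  shows "oriented_bochner_integral 0 f = 0"
  using bochner_integral_eqI[OF bochner_has_integral_continuous, of 0 0 f]
  by (simp add: oriented_bochner_integral_def)

text \<open>
  Near \<open>a\<close> the oriented integral differs by a constant from the integral with a lower bound far to
  the left, so that no case distinction at \<open>0\<close> is necessary.
\<close>

lemma oriented_bochner_integral_has_vector_derivative:
  fixes f :: "real \<Rightarrow> 'b::banach"
  assumes f: "continuous_on UNIV f"
  shows "((\<lambda>a. oriented_bochner_integral a f) has_vector_derivative f a) (at a)"
proof -
  define r where "r = \<bar>a\<bar> + 1"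
  define G where "G = (\<lambda>t. integral {- r..t} f)"
  have deriv: "(G has_vector_derivative f t) (at t within {- r..r})" if "t \<in> {- r..r}" for t
    unfolding G_def using that
    by (intro integral_has_vector_derivative continuous_on_subset[OF f]) auto
  have eq: "G t - G 0 = oriented_bochner_integral t f" if t: "t \<in> {- r<..<r}" for t
  proof (rule oriented_bochner_integral_FTC[symmetric])
    fix t' assume "t' \<in> {min 0 t..max 0 t}"
    then show "(G has_vector_derivative f t') (at t' within {min 0 t..max 0 t})"
      using t by (intro has_vector_derivative_within_subset[OF deriv]) auto
  qed (rule continuous_on_subset[OF f], simp)
  have a: "a \<in> {- r<..<r}"
    by (auto simp: r_def)
  have "(G has_vector_derivative f a) (at a within {- r<..<r})"
    using a by (intro has_vector_derivative_within_subset[OF deriv]) auto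
  then have "(G has_vector_derivative f a) (at a)"
    unfolding at_within_open[OF a open_greaterThanLessThan] .
  from has_vector_derivative_diff[OF this has_vector_derivative_const[of "G 0"]]
  have "((\<lambda>t. G t - G 0) has_vector_derivative f a) (at a)"
    by simp
  then show ?thesis
    by (rule has_vector_derivative_transform_within_open[OF _ open_greaterThanLessThan a]) (rule eq)
qed

lemma oriented_bochner_integral_continuous:
  fixes f :: "real \<Rightarrow> 'b::banach"
  assumes "continuous_on UNIV f"
  shows "continuous_on S (\<lambda>a. oriented_bochner_integral a f)"
  using has_vector_derivative_continuous[OF oriented_bochner_integral_has_vector_derivative[OF assms]]
  by (intro continuous_at_imp_continuous_on ballI)

text \<open>
  The adder of the reals is expressed by the interval integral of real-valued functions; it is
  brought under the same calculus because both integrals are values of the same primitive.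
\<close>

lemma interval_lebesgue_integral_eq_oriented:
  fixes f :: "real \<Rightarrow> real"
  assumes f: "continuous_on UNIV f"
  shows "(LBINT t=0..a. f t) = oriented_bochner_integral a f"
proof -
  have "(LBINT t=ereal 0..ereal a. f t) = oriented_bochner_integral a f - oriented_bochner_integral 0 f"
    by (rule interval_integral_FTC_finite[OF continuous_on_subset[OF f] has_vector_derivative_at_within[OF
          oriented_bochner_integral_has_vector_derivative[OF f]]]) simp
  then show ?thesis
    by (simp add: oriented_bochner_integral_0 zero_ereal_def)
qed

lemma oriented_bochner_integral_const:
  "oriented_bochner_integral a (\<lambda>_. y) = a *\<^sub>R (y :: 'b::banach)"
  using oriented_bochner_integral_FTC[of a "\<lambda>_. y" "\<lambda>t. t *\<^sub>R y"]
  by (simp add: has_vector_derivative_def bounded_linear_imp_has_derivative bounded_linear_scaleR_left)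

text \<open>
  Both sides, as functions of \<open>a\<close>, vanish at \<open>0\<close> and have the same derivative by the chain rule.
  The bounds may be passed in any direction, since \<open>h\<close> may change sign.
\<close>

lemma oriented_bochner_integral_substitution:
  fixes h :: "real \<Rightarrow> real" and g :: "real \<Rightarrow> 'b::banach"
  assumes h: "continuous_on UNIV h" and g: "continuous_on UNIV g"
  shows "oriented_bochner_integral (oriented_bochner_integral a h) g
       = oriented_bochner_integral a (\<lambda>t. h t *\<^sub>R g (oriented_bochner_integral t h))"
proof -
  let ?H = "\<lambda>t. oriented_bochner_integral t h" and ?G = "\<lambda>t. oriented_bochner_integral t g"
  have "(?G \<circ> ?H has_vector_derivative h t *\<^sub>R g (?H t)) (at t)" for t
    by (intro vector_diff_chain_at oriented_bochner_integral_has_vector_derivative h g)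
  moreover have "continuous_on S (\<lambda>t. h t *\<^sub>R g (?H t))" for S
    by (intro continuous_on_scaleR continuous_on_subset[OF h]
        continuous_on_compose2[OF g] oriented_bochner_integral_continuous h) auto
  ultimately have "oriented_bochner_integral a (\<lambda>t. h t *\<^sub>R g (?H t)) = (?G \<circ> ?H) a - (?G \<circ> ?H) 0"
    by (rule oriented_bochner_integral_FTC[OF _ has_vector_derivative_at_within, rotated])
  then show ?thesis
    by (simp add: oriented_bochner_integral_0)
qed

text \<open>
  The case of a constant speed \<open>a\<close> on \<open>[0, 1]\<close>. It trades the variable bound for a factor and a
  dilation in the integrand.
\<close>

lemma oriented_bochner_integral_rescale:
  fixes f :: "real \<Rightarrow> 'b::banach"
  assumes "continuous_on UNIV f"
  shows "oriented_bochner_integral a f = oriented_bochner_integral 1 (\<lambda>t. a *\<^sub>R f (t * a))"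
  using oriented_bochner_integral_substitution[of "\<lambda>_. a" f 1] assms
  by (simp add: oriented_bochner_integral_const)

section \<open>Continuous dependence on parameters\<close>

lemma continuous_on_slice:
  assumes f: "continuous_map (times_R U) euclidean f" and u: "u \<in> topspace U"
  shows "continuous_on UNIV (\<lambda>t. f (u, t))"
proof -
  have "continuous_map euclideanreal (times_R U) (\<lambda>t. (u, t))"
    using u by (simp add: continuous_map_pairedI)
  from continuous_map_compose[OF this f] show ?thesis
    by (simp add: o_def)
qed

lemma norm_oriented_bochner_integral_1_diff_le:
  fixes f g :: "real \<Rightarrow> 'b::banach"
  assumes f: "continuous_on UNIV f" and g: "continuous_on UNIV g"
    and le: "\<And>t. t \<in> {0..1} \<Longrightarrow> norm (f t - g t) \<le> e"
  shows "norm (oriented_bochner_integral 1 f - oriented_bochner_integral 1 g) \<le> e"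
proof -
  have cont: "continuous_on {0..1} f" "continuous_on {0..1} g"
    using f g continuous_on_subset by blast+
  then have "oriented_bochner_integral 1 f - oriented_bochner_integral 1 g
      = integral {0..1} (\<lambda>t. f t - g t)"
    by (simp add: oriented_bochner_integral_def integral_diff integrable_continuous_interval
        bochner_integral_eqI[OF bochner_has_integral_continuous])
  also have "norm \<dots> \<le> e * (1 - 0)"
    by (intro integral_bound continuous_on_diff cont le) auto
  finally show ?thesis by simp
qed

text \<open>
  The points \<open>(u, t)\<close> at which \<open>F\<close> is close to \<open>F (u\<^sub>0, t)\<close> form an open set containing the compact
  segment \<open>{u\<^sub>0} \<times> [0, 1]\<close>; by the tube lemma this set contains a strip \<open>N \<times> [0, 1]\<close>. So the
  integrands over \<open>N\<close> are uniformly close to the one over \<open>u\<^sub>0\<close>.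
\<close>

lemma continuous_map_oriented_bochner_integral_1:
  fixes F :: "'u \<times> real \<Rightarrow> 'b::banach"
  assumes F: "continuous_map (times_R U) euclidean F"
  shows "continuous_map U euclidean (\<lambda>u. oriented_bochner_integral 1 (\<lambda>t. F (u, t)))"
    (is "continuous_map U euclidean ?I")
  unfolding continuous_map_def
proof (intro conjI allI impI)
  fix V :: "'b set" assume "openin euclidean V"
  then have V: "open V" by simp
  show "openin U {u \<in> topspace U. ?I u \<in> V}"
  proof (subst openin_subopen, intro ballI)
    fix u\<^sub>0 assume u0: "u\<^sub>0 \<in> {u \<in> topspace U. ?I u \<in> V}"
    then obtain e where e: "e > 0" "\<And>y. dist y (?I u\<^sub>0) < e \<Longrightarrow> y \<in> V"
      using V unfolding open_dist by blast
    \<comment> \<open>Half of \<open>e\<close>, because the bound for the integrals is not strict.\<close>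
    define W where "W = {p \<in> topspace (times_R U). norm (F p - F (u\<^sub>0, snd p)) \<in> {..<e/2}}"
    have "continuous_map (times_R U) (times_R U) (\<lambda>p. (u\<^sub>0, snd p))"
      using u0 by (intro continuous_map_pairedI) (auto simp: continuous_map_snd)
    then have "continuous_map (times_R U) euclidean (\<lambda>p. F (u\<^sub>0, snd p))"
      using continuous_map_compose[OF _ F] by (fastforce simp: o_def)
    then have "continuous_map (times_R U) euclideanreal (\<lambda>p. norm (F p - F (u\<^sub>0, snd p)))"
      by (intro continuous_map_norm continuous_map_diff F)
    then have "openin (times_R U) W"
      unfolding W_def by (rule openin_continuous_map_preimage) simp
    moreover have "{u\<^sub>0} \<times> {0..1} \<subseteq> W"
      using u0 e(1) by (auto simp: W_def)
    ultimately obtain N T where N: "openin U N" "u\<^sub>0 \<in> N" "{0..1} \<subseteq> T" "N \<times> T \<subseteq> W"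
      using tube_lemma_right[of U euclideanreal W "{0..1}" u\<^sub>0] u0 by auto
    have "?I u \<in> V" "u \<in> topspace U" if "u \<in> N" for u
    proof -
      show u: "u \<in> topspace U"
        using that N(1) openin_subset by blast
      have "norm (F (u, t) - F (u\<^sub>0, t)) \<le> e / 2" if "t \<in> {0..1}" for t
        using \<open>u \<in> N\<close> that N(3,4) by (force simp: W_def)
      then have "norm (?I u - ?I u\<^sub>0) \<le> e / 2"
        using u u0 by (intro norm_oriented_bochner_integral_1_diff_le continuous_on_slice[OF F]) auto
      then show "?I u \<in> V"
        using e by (simp add: dist_norm)
    qed
    then show "\<exists>N. openin U N \<and> u\<^sub>0 \<in> N \<and> N \<subseteq> {u \<in> topspace U. ?I u \<in> V}"
      using N by blast
  qed
qed simp

lemma continuous_map_oriented_bochner_integral: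
  fixes f :: "'u \<times> real \<Rightarrow> 'b::banach"
  assumes x: "continuous_map U euclideanreal x" and f: "continuous_map (times_R U) euclidean f"
  shows "continuous_map U euclidean (\<lambda>u. oriented_bochner_integral (x u) (\<lambda>t. f (u, t)))"
proof -
  let ?F = "\<lambda>p. x (fst p) *\<^sub>R f (fst p, snd p * x (fst p))"
  have x': "continuous_map (times_R U) euclideanreal (\<lambda>p. x (fst p))"
    using continuous_map_compose[OF continuous_map_fst x] by (simp add: o_def)
  have "continuous_map (times_R U) (times_R U) (\<lambda>p. (fst p, snd p * x (fst p)))"
    by (intro continuous_map_pairedI continuous_map_real_mult x' continuous_map_fst continuous_map_snd)
  then have "continuous_map (times_R U) euclidean (\<lambda>p. f (fst p, snd p * x (fst p)))"
    using continuous_map_compose[OF _ f] by (fastforce simp: o_def)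
  with x' have "continuous_map (times_R U) (prod_topology euclideanreal euclidean)
      (\<lambda>p. (x (fst p), f (fst p, snd p * x (fst p))))"
    by (intro continuous_map_pairedI)
  moreover have "continuous_map (prod_topology euclideanreal euclidean) euclidean
      (\<lambda>q. fst q *\<^sub>R (snd q :: 'b))"
    unfolding prod_topology_euclidean continuous_map_iff_continuous2
    by (intro continuous_intros)
  ultimately have "continuous_map (times_R U) euclidean
      ((\<lambda>q. fst q *\<^sub>R snd q) \<circ> (\<lambda>p. (x (fst p), f (fst p, snd p * x (fst p)))))"
    by (rule continuous_map_compose)
  then have "continuous_map (times_R U) euclidean ?F"
    by (simp add: o_def)
  then have "continuous_map U euclidean (\<lambda>u. oriented_bochner_integral 1 (\<lambda>t. ?F (u, t)))"
    by (rule continuous_map_oriented_bochner_integral_1)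
  then show ?thesis
    by (rule continuous_map_eq)
      (simp add: oriented_bochner_integral_rescale[OF continuous_on_slice[OF f], symmetric])
qed

section \<open>The module axioms\<close>

lemma dep_sum_operation_bochner_sum:
  "dep_sum_operation (euclidean :: 'x::banach topology) (bochner_sum :: ('u, 'x) dep_sum)"
  unfolding dep_sum_operation_def top_hom_def bochner_sum_def
proof (intro allI impI, clarify)
  fix U :: "'u topology" and x :: "'u \<Rightarrow> real" and f :: "'u \<times> real \<Rightarrow> 'x"
  assume "continuous_map U euclideanreal x" "continuous_map (times_R U) euclidean f"
  then have "continuous_map U euclidean (\<lambda>u. oriented_bochner_integral (x u) (\<lambda>t. f (u, t)))"
    by (rule continuous_map_oriented_bochner_integral)
  then show "(\<lambda>u\<in>topspace U. oriented_bochner_integral (x u) (\<lambda>t. f (u, t)))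
      \<in> extensional (topspace U) \<and>
    continuous_map U euclidean (\<lambda>u\<in>topspace U. oriented_bochner_integral (x u) (\<lambda>t. f (u, t)))"
    using continuous_map_eq[of U euclidean _ "restrict _ (topspace U)"] by simp
qed

lemma dep_sum_natural_bochner_sum:
  "dep_sum_natural (euclidean :: 'x::banach topology)
     (bochner_sum :: ('u, 'x) dep_sum) (bochner_sum :: ('v, 'x) dep_sum)"
  unfolding dep_sum_natural_def
proof (intro allI impI, elim conjE)
  fix U :: "'u topology" and U' :: "'v topology" and h and x :: "'u \<Rightarrow> real" and y :: "'v \<Rightarrow> real"
    and g :: "'v \<times> real \<Rightarrow> 'x"
  assume h: "h \<in> top_hom U U'" and x: "x = compose (topspace U) y h"
  have "h u \<in> topspace U'" if "u \<in> topspace U" for u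
    using h that by (auto simp: top_hom_def continuous_map_def)
  then show "bochner_sum U x (compose (topspace (times_R U)) g (map_prod h id))
      = compose (topspace U) (bochner_sum U' y g) h"
    by (auto simp: x bochner_sum_def compose_def fun_eq_iff restrict_def)
qed

text \<open>
  The primitive of the constant \<open>1\<close> is the identity, so flattening along the constant \<open>1\<close> forgets
  the last coordinate, and what is integrated over \<open>[0, 1]\<close> is the constant \<open>f (u, a)\<close>.
\<close>

lemma dep_sum_unit_bochner_sum:
  "dep_sum_unit (euclidean :: 'x::banach topology) (bochner_sum :: ('u \<times> real, 'x) dep_sum)"
  unfolding dep_sum_unit_def
proof (intro allI impI, elim conjE)
  fix U :: "'u topology" and x and f :: "'u \<times> real \<Rightarrow> 'x"
  assume f: "f \<in> top_hom (times_R U) euclidean"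
  have one: "adder_one U (u, a) = 1" if "u \<in> topspace U" for u a
    using that by (simp add: adder_one_def)
  have flat: "adder_flat U (adder_one U) ((u, a), b) = (u, a)" if "u \<in> topspace U" for u a b
    using that interval_lebesgue_integral_eq_oriented[of "\<lambda>_. 1" a]
    by (simp add: adder_flat_def adder_one_def oriented_bochner_integral_const)
  show "bochner_sum (times_R U) (adder_one U)
      (compose (topspace (times_R (times_R U))) f (adder_flat U (adder_one U))) = f"
  proof (rule extensionalityI[of _ "topspace (times_R U)"])
    fix p assume "p \<in> topspace (times_R U)"
    then obtain u a where p: "p = (u, a)" "u \<in> topspace U" by auto
    then show "bochner_sum (times_R U) (adder_one U)
        (compose (topspace (times_R (times_R U))) f (adder_flat U (adder_one U))) p = f p"
      by (simp add: bochner_sum_def compose_def flat one oriented_bochner_integral_const)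
  qed (use f in \<open>auto simp: bochner_sum_def top_hom_def\<close>)
qed

text \<open>
  Flattening does not depend on the last coordinate, so the inner sum at \<open>(u, t)\<close> is the integral of
  a constant from \<open>0\<close> to \<open>f (u, t)\<close>. What remains is the substitution rule on each slice.
\<close>

lemma dep_sum_assoc_bochner_sum:
  "dep_sum_assoc (euclidean :: 'x::banach topology)
     (bochner_sum :: ('u, 'x) dep_sum) (bochner_sum :: ('u \<times> real, 'x) dep_sum)"
  unfolding dep_sum_assoc_def
proof (intro allI impI, elim conjE)
  fix U :: "'u topology" and x f and g :: "'u \<times> real \<Rightarrow> 'x"
  assume "f \<in> top_hom (times_R U) euclideanreal" "g \<in> top_hom (times_R U) euclidean"
  then have f: "continuous_on UNIV (\<lambda>t. f (u, t))" and g: "continuous_on UNIV (\<lambda>t. g (u, t))"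
    if "u \<in> topspace U" for u
    using that by (auto simp: top_hom_def intro: continuous_on_slice)
  have inner: "bochner_sum (times_R U) f (compose (topspace (times_R (times_R U))) g (adder_flat U f)) (u, t)
      = f (u, t) *\<^sub>R g (u, oriented_bochner_integral t (\<lambda>t. f (u, t)))"
    if "u \<in> topspace U" for u t
    using that
    by (simp add: bochner_sum_def compose_def adder_flat_def oriented_bochner_integral_const
        interval_lebesgue_integral_eq_oriented[OF f])
  show "bochner_sum U (adder_sum U x f) g
      = bochner_sum U x (bochner_sum (times_R U) f
          (compose (topspace (times_R (times_R U))) g (adder_flat U f)))"
    unfolding bochner_sum_def[of U]
  proof (rule restrict_ext)
    fix u assume u: "u \<in> topspace U"
    then show "oriented_bochner_integral (adder_sum U x f u) (\<lambda>t. g (u, t))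
        = oriented_bochner_integral (x u) (\<lambda>t. bochner_sum (times_R U) f
            (compose (topspace (times_R (times_R U))) g (adder_flat U f)) (u, t))"
      by (simp add: inner adder_sum_def interval_lebesgue_integral_eq_oriented[OF f]
          oriented_bochner_integral_substitution[OF f g] del: topspace_prod_topology)
  qed
qed

theorem theorem4p3:
  shows "dependent_right_R_module (euclidean :: 'x::banach topology)
           (bochner_sum :: ('u, 'x) dep_sum)
           (bochner_sum :: ('v, 'x) dep_sum)
           (bochner_sum :: ('u \<times> real, 'x) dep_sum)"
  unfolding dependent_right_R_module_def
  by (intro conjI metrizable_space_euclidean dep_sum_operation_bochner_sum
      dep_sum_natural_bochner_sum dep_sum_unit_bochner_sum dep_sum_assoc_bochner_sum)

end
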